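(* Let $r\ge 0$, $t\ge 0$, $k\ge 0$ and $\ell\ge 1$ be integers, and let $H$ and $L$ be graphs such that $H$ has treewidth at most $t$ and $\Delta(L^r)\le k$. If a graph $G$ is an $r$-shallow minor of $H\boxtimes L\boxtimes K_\ell$, then $G$ is contained in $J\boxtimes L^{2r+1}\boxtimes K_{\ell(k+1)}$ for some graph $J$ with treewidth at most $\binom{2r+1+t}{t}-1$.
   Context: All graphs are finite, simple and undirected. A graph $G$ is contained in a graph $G'$ if $G$ is isomorphic to a subgraph of $G'$. The strong product $G_1\boxtimes G_2$ has vertex set $V(G_1)\times V(G_2)$, with distinct vertices $(a,v),(b,u)$ adjacent iff ($ab\in E(G_1)$ and $u=v$) or ($a=b$ and $uv\in E(G_2)$) or ($ab\in E(G_1)$ and $uv\in E(G_2)$); the strong product is associative. $K_\ell$ is the complete graph on $\ell$ vertices. For an integer $m\ge 0$, the $m$-th power $L^m$ of $L$ has vertex set $V(L)$ with distinct $u,v$ adjacent iff $\mathrm{dist}_L(u,v)\le m$. $\Delta$ denotes maximum degree. A model of a graph $G$ in a graph $G'$ is a map $\mu$ assigning to each $v\in V(G)$ a connected subgraph $\mu(v)$ of $G'$ such that the $\mu(v)$ are pairwise vertex-disjoint and for every edge $vw\in E(G)$ some edge of $G'$ joins a vertex of $\mu(v)$ to a vertex of $\mu(w)$. $G$ is an $r$-shallow minor of $G'$ if there is such a model in which every $\mu(v)$ has radius at most $r$ (i.e. contains a vertex at distance at most $r$ within $\mu(v)$ from all vertices of $\mu(v)$). *)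

theory Defs
  imports Main
begin

type_synonym 'a graph = "'a set \<times> ('a \<Rightarrow> 'a \<Rightarrow> bool)"

definition verts :: "'a graph \<Rightarrow> 'a set" where "verts G = fst G"
definition adj :: "'a graph \<Rightarrow> 'a \<Rightarrow> 'a \<Rightarrow> bool" where "adj G = snd G"

definition graph :: "'a graph \<Rightarrow> bool" where
  "graph G \<longleftrightarrow> finite (verts G) \<and>
     (\<forall>u v. adj G u v \<longrightarrow> u \<in> verts G \<and> v \<in> verts G \<and> u \<noteq> v \<and> adj G v u)"

definition strong_prod :: "'a graph \<Rightarrow> 'b graph \<Rightarrow> ('a \<times> 'b) graph" where
  "strong_prod G1 G2 = (verts G1 \<times> verts G2,
     \<lambda>(a, v) (b, u). a \<in> verts G1 \<and> b \<in> verts G1 \<and> v \<in> verts G2 \<and> u \<in> verts G2 \<and>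
        (a, v) \<noteq> (b, u) \<and>
        ((adj G1 a b \<and> u = v) \<or> (a = b \<and> adj G2 u v) \<or> (adj G1 a b \<and> adj G2 u v)))"

definition complete_graph :: "nat \<Rightarrow> nat graph" where
  "complete_graph l = ({0..<l}, \<lambda>i j. i < l \<and> j < l \<and> i \<noteq> j)"

definition graph_power :: "'a graph \<Rightarrow> nat \<Rightarrow> 'a graph" where
  "graph_power L m = (verts L, \<lambda>u v. u \<in> verts L \<and> v \<in> verts L \<and> u \<noteq> v \<and>
      (\<exists>n\<le>m. (adj L ^^ n) u v))"

definition max_degree :: "'a graph \<Rightarrow> nat" where
  "max_degree G = (if verts G = {} then 0
     else Max ((\<lambda>v. card {u \<in> verts G. adj G v u}) ` verts G))"

definition contained_in :: "'a graph \<Rightarrow> 'b graph \<Rightarrow> bool" where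
  "contained_in G G' \<longleftrightarrow> (\<exists>f. inj_on f (verts G) \<and> f ` verts G \<subseteq> verts G' \<and>
     (\<forall>u v. adj G u v \<longrightarrow> adj G' (f u) (f v)))"

definition adj_in :: "'a graph \<Rightarrow> 'a set \<Rightarrow> 'a \<Rightarrow> 'a \<Rightarrow> bool" where
  "adj_in G S = (\<lambda>a b. adj G a b \<and> a \<in> S \<and> b \<in> S)"

definition connected_on :: "'a graph \<Rightarrow> 'a set \<Rightarrow> bool" where
  "connected_on G S \<longleftrightarrow> S \<subseteq> verts G \<and> S \<noteq> {} \<and>
     (\<forall>x\<in>S. \<forall>y\<in>S. (adj_in G S)\<^sup>*\<^sup>* x y)"

definition radius_le :: "'a graph \<Rightarrow> 'a set \<Rightarrow> nat \<Rightarrow> bool" where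
  "radius_le G S r \<longleftrightarrow> (\<exists>c\<in>S. \<forall>x\<in>S. \<exists>n\<le>r. (adj_in G S ^^ n) c x)"

definition acyclic_graph :: "'a graph \<Rightarrow> bool" where
  "acyclic_graph T \<longleftrightarrow> \<not> (\<exists>xs. length xs \<ge> 3 \<and> distinct xs \<and>
      (\<forall>i. Suc i < length xs \<longrightarrow> adj T (xs ! i) (xs ! Suc i)) \<and> adj T (last xs) (hd xs))"

definition tree :: "'a graph \<Rightarrow> bool" where
  "tree T \<longleftrightarrow> graph T \<and> connected_on T (verts T) \<and> acyclic_graph T"

definition tree_decomposition :: "'a graph \<Rightarrow> nat graph \<Rightarrow> (nat \<Rightarrow> 'a set) \<Rightarrow> bool" where
  "tree_decomposition G T B \<longleftrightarrow> tree T \<and>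
     (\<forall>x\<in>verts T. B x \<subseteq> verts G) \<and>
     (\<forall>v\<in>verts G. \<exists>x\<in>verts T. v \<in> B x) \<and>
     (\<forall>u v. adj G u v \<longrightarrow> (\<exists>x\<in>verts T. u \<in> B x \<and> v \<in> B x)) \<and>
     (\<forall>v\<in>verts G. connected_on T {x \<in> verts T. v \<in> B x})"

definition treewidth :: "'a graph \<Rightarrow> nat" where
  "treewidth G = (LEAST w. \<exists>T B. tree_decomposition G T B \<and>
       (\<forall>x\<in>verts T. card (B x) \<le> w + 1))"

definition shallow_minor :: "nat \<Rightarrow> 'a graph \<Rightarrow> 'b graph \<Rightarrow> bool" where
  "shallow_minor r G G' \<longleftrightarrow> (\<exists>\<mu> :: 'a \<Rightarrow> 'b set.
     (\<forall>v\<in>verts G. connected_on G' (\<mu> v) \<and> radius_le G' (\<mu> v) r) \<and>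
     (\<forall>v\<in>verts G. \<forall>w\<in>verts G. v \<noteq> w \<longrightarrow> \<mu> v \<inter> \<mu> w = {}) \<and>
     (\<forall>v w. adj G v w \<longrightarrow> (\<exists>x\<in>\<mu> v. \<exists>y\<in>\<mu> w. adj G' x y)))"

end

(* Number the vertices of H by an elimination order coming from a tree decomposition: each vertex then
   has at most t smaller neighbours, forming a clique, in a chordal graph R containing H. Join x and y
   in J when one is reached from the other by at most 2r+1 descending steps of R. Bags of descending
   reachable sets form a tree decomposition of J, and such a set has at most (2r+1+t choose t) elements.
   A vertex v of G is sent to the least vertex x of the projection of its branch set to H and to the
   L-coordinate of the centre of the branch set. At most l(k+1) disjoint branch sets share these data,
   since each contains a vertex over x whose L-coordinate is within distance r of the centre.
   If vw is an edge with minima x <= y, there is a walk of length at most 2r+1 to x from a vertex q of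
   the branch set of w. As q also descends to y, chordality reroutes the walk into a descent from y. *)

theory Submission
  imports Defs
begin

section \<open>Walks and products\<close>

lemma relpowp_map:
  assumes "(Q ^^ n) a b" and "\<And>x y. Q x y \<Longrightarrow> Q' (f x) (f y)"
  shows "(Q' ^^ n) (f a) (f b)"
  using assms(1)
proof (induction n arbitrary: b)
  case (Suc n)
  then show ?case using assms(2) by (metis relpowp_Suc_E relpowp_Suc_I)
qed simp

lemma relpowp_trans: "(Q ^^ m) a b \<Longrightarrow> (Q ^^ n) b c \<Longrightarrow> (Q ^^ (m + n)) a c"
  by (metis relcomppI relpowp_add)

lemma relpowp_sym:
  assumes "(Q ^^ n) a b" and "\<And>x y. Q x y \<Longrightarrow> Q y x"
  shows "(Q ^^ n) b a"
  using assms(1)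
proof (induction n arbitrary: b)
  case (Suc n)
  then show ?case using assms(2) by (metis relpowp_Suc_E relpowp_Suc_I2)
qed simp

lemma rtranclp_sym:
  assumes "Q\<^sup>*\<^sup>* a b" and "\<And>x y. Q x y \<Longrightarrow> Q y x"
  shows "Q\<^sup>*\<^sup>* b a"
  using assms by (metis relpowp_imp_rtranclp relpowp_sym rtranclp_imp_relpowp)

text \<open>Stationary steps can be deleted. A walk in a strong product projects to a walk that may
  stand still, and this turns such a projection into a genuine walk of no greater length.\<close>

lemma relpowp_reflclp:
  assumes "((\<lambda>x y. x = y \<or> Q x y) ^^ n) a b"
  shows "\<exists>m\<le>n. (Q ^^ m) a b"
  using assms
proof (induction n arbitrary: b)
  case (Suc n)
  then obtain c where c: "((\<lambda>x y. x = y \<or> Q x y) ^^ n) a c" "c = b \<or> Q c b"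
    by auto
  with Suc.IH obtain m where m: "m \<le> n" "(Q ^^ m) a c" by blast
  show ?case
  proof (cases "c = b")
    case True
    then show ?thesis using m le_SucI by blast
  next
    case False
    then have "(Q ^^ Suc m) a b" using c m by auto
    then show ?thesis using m(1) Suc_le_mono by blast
  qed
qed simp

section \<open>Graphs, powers and strong products\<close>

lemma graph_adjD:
  assumes "graph G" "adj G u v"
  shows "u \<in> verts G" "v \<in> verts G" "u \<noteq> v" "adj G v u"
  using assms by (auto simp: graph_def)

lemma verts_strong_prod [simp]: "verts (strong_prod A B) = verts A \<times> verts B"
  by (simp add: strong_prod_def verts_def)

lemma verts_graph_power [simp]: "verts (graph_power L m) = verts L"
  by (simp add: graph_power_def verts_def)

lemma verts_complete_graph [simp]: "verts (complete_graph n) = {0..<n}"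
  by (simp add: complete_graph_def verts_def)

lemma adj_complete_graph [simp]: "adj (complete_graph n) i j \<longleftrightarrow> i < n \<and> j < n \<and> i \<noteq> j"
  by (simp add: complete_graph_def adj_def)

lemma adj_graph_power:
  "adj (graph_power L m) u v \<longleftrightarrow>
     u \<in> verts L \<and> v \<in> verts L \<and> u \<noteq> v \<and> (\<exists>n\<le>m. (adj L ^^ n) u v)"
  by (simp add: graph_power_def adj_def)

lemma graph_complete_graph: "graph (complete_graph n)"
  by (auto simp: graph_def)

lemma graph_graph_power:
  assumes "graph L"
  shows "graph (graph_power L m)"
proof -
  have "(adj L ^^ n) v u" if "(adj L ^^ n) u v" for n u v
    using relpowp_sym[OF that] graph_adjD(4)[OF assms] by blast
  then show ?thesis using assms by (auto simp: graph_def adj_graph_power)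
qed

text \<open>The three cases of the definition merge into "equal or adjacent" in each coordinate.
  \<open>graph B\<close> supplies symmetry, because the definition reads the second coordinates in
  reversed order.\<close>

lemma adj_strong_prod:
  assumes "graph B"
  shows "adj (strong_prod A B) p q \<longleftrightarrow>
    p \<in> verts A \<times> verts B \<and> q \<in> verts A \<times> verts B \<and> p \<noteq> q \<and>
    (fst p = fst q \<or> adj A (fst p) (fst q)) \<and> (snd p = snd q \<or> adj B (snd p) (snd q))"
  using graph_adjD(4)[OF assms]
  by (cases p; cases q) (auto simp: strong_prod_def adj_def verts_def)

lemma graph_strong_prod:
  assumes "graph A" "graph B"
  shows "graph (strong_prod A B)"
proof -
  have "finite (verts A)" "finite (verts B)" using assms by (simp_all add: graph_def)
  then show ?thesis
    unfolding graph_def adj_strong_prod[OF assms(2)]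
    using graph_adjD(4)[OF assms(1)] graph_adjD(4)[OF assms(2)]
    by (metis finite_cartesian_product verts_strong_prod)
qed

text \<open>Adjacency is symmetric, so paths to one hub \<open>c\<close> link any two
  vertices.\<close>

lemma connected_on_star:
  assumes "graph G" "S \<subseteq> verts G" "c \<in> S" "\<And>x. x \<in> S \<Longrightarrow> (adj_in G S)\<^sup>*\<^sup>* x c"
  shows "connected_on G S"
proof -
  have "adj_in G S x y \<Longrightarrow> adj_in G S y x" for x y
    using graph_adjD[OF assms(1)] by (auto simp: adj_in_def)
  then have "(adj_in G S)\<^sup>*\<^sup>* x y" if "x \<in> S" "y \<in> S" for x y
    using assms(4) that by (meson rtranclp_sym rtranclp_trans)
  then show ?thesis using assms by (auto simp: connected_on_def)
qed

section \<open>Rooting a tree\<close>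

text \<open>The path grows edge by edge; when the next vertex already occurs, the list is cut off
  right after that occurrence, so nothing repeats.\<close>

lemma distinct_path:
  assumes "(adj_in G S)\<^sup>*\<^sup>* a b" "a \<in> S"
  shows "\<exists>xs. xs \<noteq> [] \<and> distinct xs \<and> hd xs = a \<and> last xs = b \<and> set xs \<subseteq> S \<and>
    successively (adj G) xs"
  using assms(1)
proof induction
  case base
  show ?case by (rule exI[of _ "[a]"]) (use assms(2) in auto)
next
  case (step y z)
  then obtain xs where xs: "xs \<noteq> []" "distinct xs" "hd xs = a" "last xs = y" "set xs \<subseteq> S"
    "successively (adj G) xs" by blast
  have yz: "adj G y z" "z \<in> S" using step(2) by (auto simp: adj_in_def)
  show ?case
  proof (cases "z \<in> set xs")
    case True
    then obtain us vs where s: "xs = us @ z # vs" by (meson split_list)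
    show ?thesis
      by (rule exI[of _ "us @ [z]"])
        (use xs s in \<open>auto simp: successively_append_iff hd_append split: if_splits\<close>)
  next
    case False
    show ?thesis
      by (rule exI[of _ "xs @ [z]"])
        (use xs yz False in \<open>auto simp: successively_append_iff\<close>)
  qed
qed

text \<open>If \<open>a\<close> and \<open>b\<close> differed, a simple path between them inside
  \<open>S\<close>, closed up through \<open>v\<close>, would be a cycle.\<close>

lemma acyclic_unique_neighbour:
  assumes "graph T" "acyclic_graph T" "connected_on T S" "a \<in> S" "b \<in> S" "v \<notin> S"
    "adj T v a" "adj T v b"
  shows "a = b"
proof (rule ccontr)
  assume "a \<noteq> b"
  have "(adj_in T S)\<^sup>*\<^sup>* a b" using assms by (auto simp: connected_on_def)
  from distinct_path[OF this \<open>a \<in> S\<close>] obtain xs where xs: "xs \<noteq> []" "distinct xs" "hd xs = a"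
    "last xs = b" "set xs \<subseteq> S" "successively (adj T) xs" by blast
  have "length xs \<ge> 2" using xs \<open>a \<noteq> b\<close> by (cases xs; cases "tl xs") auto
  moreover have "distinct (v # xs)" using xs assms(6) by auto
  moreover have "successively (adj T) (v # xs)" using xs assms(7) by (cases xs) auto
  moreover have "adj T (last (v # xs)) (hd (v # xs))"
    using xs graph_adjD(4)[OF assms(1,8)] by simp
  ultimately have "\<not> acyclic_graph T"
    unfolding acyclic_graph_def successively_conv_nth
    by (metis (no_types, lifting) Suc_le_mono length_Cons numeral_2_eq_2 numeral_3_eq_3)
  then show False using assms(2) by simp
qed

lemma connected_on_boundary_edge:
  assumes "connected_on T V" "S \<subseteq> V" "S \<noteq> {}" "S \<noteq> V"
  shows "\<exists>a\<in>S. \<exists>v\<in>V - S. adj T a v"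
proof (rule ccontr)
  assume neg: "\<not> ?thesis"
  obtain a b where ab: "a \<in> S" "b \<in> V - S" using assms by blast
  then have "(adj_in T V)\<^sup>*\<^sup>* a b" using assms by (auto simp: connected_on_def)
  then have "b \<in> S" by induction (use ab neg in \<open>auto simp: adj_in_def\<close>)
  then show False using ab by simp
qed

text \<open>A subtree grows by one vertex at a time, labelled in order of arrival. A newcomer has
  only one neighbour in the connected set \<open>S\<close>, and its label exceeds all others, so it
  is never a smaller neighbour of an older vertex.\<close>

lemma partial_rooting:
  assumes "tree T" "Suc n \<le> card (verts T)"
  shows "\<exists>S (f :: 'a \<Rightarrow> nat). S \<subseteq> verts T \<and> card S = Suc n \<and> connected_on T S \<and> inj_on f S \<and>
    (\<forall>x\<in>S. f x \<le> n) \<and>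
    (\<forall>x\<in>S. \<forall>y\<in>S. \<forall>z\<in>S. adj T x y \<and> adj T x z \<and> f y < f x \<and> f z < f x \<longrightarrow> y = z)"
  using assms(2)
proof (induction n)
  case 0
  obtain c where c: "c \<in> verts T" using 0 by fastforce
  show ?case
    by (rule exI[of _ "{c}"], rule exI[of _ "\<lambda>_. 0"]) (use c in \<open>auto simp: connected_on_def\<close>)
next
  case (Suc n)
  have T: "graph T" "connected_on T (verts T)" "acyclic_graph T"
    using assms(1) by (auto simp: tree_def)
  obtain S and f :: "'a \<Rightarrow> nat" where S: "S \<subseteq> verts T" "card S = Suc n" "connected_on T S" "inj_on f S"
    "\<forall>x\<in>S. f x \<le> n"
    "\<forall>x\<in>S. \<forall>y\<in>S. \<forall>z\<in>S. adj T x y \<and> adj T x z \<and> f y < f x \<and> f z < f x \<longrightarrow> y = z"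
    using Suc by auto
  have fin: "finite S" using S(2) card.infinite by fastforce
  have "S \<noteq> {}" "S \<noteq> verts T" using S(2) Suc.prems by auto
  from connected_on_boundary_edge[OF T(2) S(1) this]
  obtain a v where av: "a \<in> S" "v \<in> verts T" "v \<notin> S" "adj T a v" by blast
  let ?S = "insert v S" and ?f = "f(v := Suc n)"
  have va: "adj T v a" using graph_adjD(4)[OF T(1) av(4)] .
  have "(adj_in T ?S)\<^sup>*\<^sup>* x a" if "x \<in> ?S" for x
  proof (cases "x = v")
    case True
    then show ?thesis using va av by (auto simp: adj_in_def)
  next
    case False
    then have "(adj_in T S)\<^sup>*\<^sup>* x a" using S(3) av(1) that by (auto simp: connected_on_def)
    then show ?thesis by (rule rtranclp_mono[THEN predicate2D, rotated]) (auto simp: adj_in_def)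
  qed
  then have "connected_on T ?S"
    using connected_on_star[OF T(1), of ?S a] S(1) av by auto
  moreover have "y = z" if "x \<in> ?S" "y \<in> ?S" "z \<in> ?S" "adj T x y" "adj T x z"
    "?f y < ?f x" "?f z < ?f x" for x y z
  proof (cases "x = v")
    case True
    then show ?thesis
      using acyclic_unique_neighbour[OF T(1,3) S(3) _ _ av(3)] that by auto
  next
    case False
    then have "f x \<le> n" using S(5) that by auto
    then have "y \<noteq> v" "z \<noteq> v" using that False by (auto split: if_splits)
    then show ?thesis using S(6) that False by auto
  qed
  moreover have "inj_on ?f ?S"
  proof -
    have "inj_on ?f S" using S(4) av(3) by (simp add: inj_on_fun_updI inj_on_def)
    moreover have "?f v \<notin> ?f ` S"
    proof
      assume "?f v \<in> ?f ` S"
      then obtain x where "x \<in> S" "Suc n = f x" using av(3) by (auto split: if_splits)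
      then show False using S(5) by force
    qed
    ultimately show ?thesis using av(3) by simp
  qed
  moreover have "?S \<subseteq> verts T" "card ?S = Suc (Suc n)" "\<forall>x\<in>?S. ?f x \<le> Suc n"
    using S(1,2,5) av(2,3) fin by (auto simp: le_SucI)
  ultimately show ?case by (intro exI[of _ ?S] exI[of _ ?f] conjI) blast+
qed

text \<open>The labelling encodes a rooting: the parent of a node is its only neighbour with a
  smaller label.\<close>

lemma tree_rooting:
  assumes "tree T"
  shows "\<exists>f :: 'a \<Rightarrow> nat. inj_on f (verts T) \<and>
    (\<forall>x y z. adj T x y \<and> adj T x z \<and> f y < f x \<and> f z < f x \<longrightarrow> y = z)"
proof -
  have T: "graph T" "verts T \<noteq> {}" "finite (verts T)"
    using assms by (auto simp: tree_def connected_on_def graph_def)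
  then have "card (verts T) > 0" by (simp add: card_gt_0_iff)
  then obtain n where n: "card (verts T) = Suc n" using gr0_implies_Suc by blast
  from partial_rooting[OF assms, of n] n obtain S and f :: "'a \<Rightarrow> nat"
    where S: "S \<subseteq> verts T" "card S = Suc n" "inj_on f S"
    "\<forall>x\<in>S. \<forall>y\<in>S. \<forall>z\<in>S. adj T x y \<and> adj T x z \<and> f y < f x \<and> f z < f x \<longrightarrow> y = z"
    by auto
  have "S = verts T" using S n T(3) by (simp add: card_subset_eq)
  then show ?thesis using S graph_adjD[OF T(1)] by metis
qed

text \<open>The neighbour found is the parent of \<open>i\<close>, whatever \<open>C\<close> is.
  Hence two connected node sets that both contain \<open>i\<close> and both reach smaller labels can
  climb together.\<close>

lemma connected_on_ascend:
  fixes f :: "'a \<Rightarrow> nat"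
  assumes "graph T" "inj_on f (verts T)"
    and uniq: "\<And>x y z. adj T x y \<Longrightarrow> adj T x z \<Longrightarrow> f y < f x \<Longrightarrow> f z < f x \<Longrightarrow> y = z"
    and "connected_on T C" "i \<in> C" "m \<in> C" "f m < f i"
  shows "\<exists>j\<in>C. adj T i j \<and> f j < f i"
proof (rule ccontr)
  assume neg: "\<not> ?thesis"
  let ?up = "\<lambda>a b. adj T a b \<and> f b < f a"
  have "(adj_in T C)\<^sup>*\<^sup>* i m" using assms by (auto simp: connected_on_def)
  \<comment> \<open>leaving the part of the tree below \<open>i\<close> is possible only through the parent of \<open>i\<close>\<close>
  then have "?up\<^sup>*\<^sup>* m i"
  proof induction
    case (step j j')
    have a: "adj T j j'" "j \<in> C" "j' \<in> C" using step(2) by (auto simp: adj_in_def)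
    note g = graph_adjD[OF assms(1) a(1)]
    have "f j \<noteq> f j'" using g assms(2) by (meson inj_on_eq_iff)
    then consider "f j' < f j" | "f j < f j'" by linarith
    then show ?case
    proof cases
      case 1
      from step.IH show ?thesis
      proof (cases rule: converse_rtranclpE)
        case base
        then show ?thesis using neg a 1 by blast
      next
        case (step b)
        then have "b = j'" using uniq a(1) 1 by blast
        then show ?thesis using step by simp
      qed
    next
      case 2
      then show ?thesis using g(4) step.IH by (simp add: converse_rtranclp_into_rtranclp)
    qed
  qed simp
  then have "f i \<le> f m" by induction auto
  then show False using assms(7) by simp
qed

section \<open>Elimination orders\<close>

text \<open>A chordal graph with its edges directed from larger to smaller numbers; removing
  vertices in decreasing order is a perfect elimination ordering.\<close>

definition elimination :: "(nat \<Rightarrow> nat \<Rightarrow> bool) \<Rightarrow> bool" where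
  "elimination R \<longleftrightarrow> (\<forall>y x. R y x \<longrightarrow> x < y) \<and> (\<forall>z a b. R z a \<and> R z b \<and> a < b \<longrightarrow> R b a)"

text \<open>For an elimination relation these are the weakly \<open>s\<close>-reachable sets of
  generalised colouring numbers, by \<open>walk_to_min_descends\<close>.\<close>

definition descents :: "(nat \<Rightarrow> nat \<Rightarrow> bool) \<Rightarrow> nat \<Rightarrow> nat \<Rightarrow> nat set" where
  "descents R s y = {x. \<exists>n\<le>s. (R ^^ n) y x}"

lemma elimination_less: "elimination R \<Longrightarrow> R y x \<Longrightarrow> x < y"
  unfolding elimination_def by blast

lemma elimination_clique: "elimination R \<Longrightarrow> R z a \<Longrightarrow> R z b \<Longrightarrow> a < b \<Longrightarrow> R b a"
  unfolding elimination_def by metis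

section \<open>Counting descents\<close>

lemma descentsI: "(R ^^ n) y x \<Longrightarrow> n \<le> s \<Longrightarrow> x \<in> descents R s y"
  by (auto simp: descents_def)

lemma self_in_descents: "y \<in> descents R s y"
  by (rule descentsI[of 0]) simp_all

lemma descents_mono: "s \<le> s' \<Longrightarrow> descents R s y \<subseteq> descents R s' y"
  unfolding descents_def by (blast intro: order_trans)

lemma descents_sink:
  assumes "\<And>x. \<not> R y x"
  shows "descents R s y = {y}"
proof -
  have "n = 0" if "(R ^^ n) y x" for n x
    using that assms by (cases n) (auto simp del: relpowp.simps dest: relpowp_Suc_D2)
  then show ?thesis by (force simp: descents_def)
qed

text \<open>At each step both \<open>u\<close> and the next vertex are out-neighbours of the current
  one, hence adjacent, and \<open>u\<close> is the smaller.\<close>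

lemma elimination_restrict_above:
  assumes "elimination R" "R y u" "(\<lambda>z x. R z x \<and> u < x)\<^sup>*\<^sup>* y z"
  shows "R z u"
  using assms(3)
proof induction
  case (step z x)
  then show ?case using elimination_clique[OF assms(1), of z u x] by blast
qed (rule assms(2))

text \<open>At the first step to \<open>u\<close> or below, the vertex being left still has
  \<open>u\<close> as an out-neighbour. So the walk either hits \<open>u\<close> or jumps past it to
  an out-neighbour of \<open>u\<close>. \<open>Suc m\<close> accounts for the edge from
  \<open>y\<close> to \<open>u\<close>.\<close>

lemma elimination_descent_via_min:
  assumes el: "elimination R" and u: "R y u" "\<And>x. R y x \<Longrightarrow> u \<le> x"
    and R': "R' = (\<lambda>z x. R z x \<and> u < x)" and "(R ^^ n) y x"
  shows "(R' ^^ n) y x \<or> (\<exists>m. Suc m \<le> n \<and> (R ^^ m) u x)"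
  using assms(5)
proof (induction n arbitrary: x)
  case (Suc n)
  note inv = elimination_restrict_above[OF el u(1), folded R']
  from Suc.prems obtain z where z: "(R ^^ n) y z" "R z x" by auto
  from Suc.IH[OF z(1)] show ?case
  proof
    assume l: "(R' ^^ n) y z"
    have zu: "R z u" using inv relpowp_imp_rtranclp[OF l] .
    consider "u < x" | "x = u" | "x < u" by linarith
    then show ?thesis
    proof cases
      case 1
      then show ?thesis using l z(2) R' by auto
    next
      case 2
      then show ?thesis by (intro disjI2 exI[of _ 0]) auto
    next
      case 3
      have ux: "R u x" by (rule elimination_clique[OF el z(2) zu 3])
      \<comment> \<open>Otherwise \<open>z = y\<close> would have an out-neighbour below its least
        one. The jump past \<open>u\<close> is therefore not the first step, which leaves room for
        the detour.\<close>
      have "n \<noteq> 0" using z u(2) 3 by (cases n) force+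
      then show ?thesis using ux by (intro disjI2 exI[of _ 1]) auto
    qed
  next
    assume "\<exists>m. Suc m \<le> n \<and> (R ^^ m) u z"
    then obtain m where "Suc m \<le> n" "(R ^^ m) u z" by blast
    then show ?thesis using z(2) by (intro disjI2 exI[of _ "Suc m"]) auto
  qed
qed simp

text \<open>Let \<open>u\<close> be the least out-neighbour of \<open>y\<close>. Every vertex above \<open>u\<close> reachable from \<open>y\<close> has
  \<open>u\<close> as an out-neighbour, so above \<open>u\<close> the out-degrees drop by one; every descent to \<open>u\<close> or below
  can be rerouted through \<open>u\<close>, which costs a step. The count then follows Pascal's rule.\<close>

lemma card_descents:
  assumes "elimination R"
    and "\<And>z. R\<^sup>*\<^sup>* y z \<Longrightarrow> finite {x. R z x} \<and> card {x. R z x} \<le> t"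
  shows "finite (descents R s y) \<and> card (descents R s y) \<le> (s + t choose t)"
  using assms
proof (induction t arbitrary: R y s)
  case 0
  have "finite {x. R y x} \<and> card {x. R y x} \<le> 0" using "0.prems"(2) by blast
  then have "{x. R y x} = {}" by auto
  then show ?case by (subst (1 2) descents_sink) auto
next
  case (Suc t)
  \<comment> \<open>The outer hypothesis will serve the restricted relation \<open>R'\<close> at
    \<open>y\<close>; the inner induction on \<open>s\<close> keeps \<open>R\<close> and restarts at
    \<open>u\<close>.\<close>
  note IHt = Suc.IH
  from Suc.prems show ?case
  proof (induction s arbitrary: y)
    case 0
    have "descents R 0 y = {y}" by (auto simp: descents_def)
    then show ?case by simp
  next
    case (Suc s)
    note el = Suc.prems(1)
    have N: "finite {x. R y x}" using Suc.prems(2) by blast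
    show ?case
    proof (cases "{x. R y x} = {}")
      case True
      then have "descents R (Suc s) y = {y}" by (intro descents_sink) auto
      then have "finite (descents R (Suc s) y)" "card (descents R (Suc s) y) = 1" by simp_all
      moreover have "(Suc s + Suc t choose Suc t) > 0" by (subst zero_less_binomial_iff) simp
      ultimately show ?thesis by linarith
    next
      case False
      define u where "u = Min {x. R y x}"
      have u: "R y u" using Min_in[OF N False] by (simp add: u_def)
      have umin: "u \<le> x" if "R y x" for x using that N by (simp add: u_def)
      define R' where "R' = (\<lambda>z x. R z x \<and> u < x)"
      have el': "elimination R'"
        unfolding elimination_def R'_def
        using elimination_less[OF el] elimination_clique[OF el] by (metis (no_types, lifting))
      have sub: "R\<^sup>*\<^sup>* y z" if "R'\<^sup>*\<^sup>* y z" for z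
        using that by (rule rtranclp_mono[THEN predicate2D, rotated]) (auto simp: R'_def)
      note inv = elimination_restrict_above[OF el u, folded R'_def]
      \<comment> \<open>The out-degree is known to drop only at vertices reachable from
        \<open>y\<close>, which is why degrees are bounded only along reachable vertices.\<close>
      have deg': "finite {x. R' z x} \<and> card {x. R' z x} \<le> t" if "R'\<^sup>*\<^sup>* y z" for z
      proof -
        have f: "finite {x. R z x}" "card {x. R z x} \<le> Suc t"
          using Suc.prems(2)[OF sub[OF that]] by auto
        have "{x. R' z x} \<subseteq> {x. R z x} - {u}" by (auto simp: R'_def)
        moreover have "card ({x. R z x} - {u}) \<le> t"
          using f inv[OF that] by (simp add: card_Diff_singleton)
        ultimately show ?thesis using f
          by (metis (no_types, lifting) card_mono finite_Diff finite_subset order_trans)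
      qed
      have 1: "finite (descents R' (Suc s) y)"
        "card (descents R' (Suc s) y) \<le> (Suc s + t choose t)"
        using IHt[OF el' deg', of y "Suc s"] by auto
      have 2: "finite (descents R s u)" "card (descents R s u) \<le> (s + Suc t choose Suc t)"
        using Suc.IH[OF el, of u] Suc.prems(2) u
        by (auto simp: converse_rtranclp_into_rtranclp)
      have cover: "descents R (Suc s) y \<subseteq> descents R' (Suc s) y \<union> descents R s u"
      proof
        fix x assume "x \<in> descents R (Suc s) y"
        then obtain n where n: "n \<le> Suc s" "(R ^^ n) y x" by (auto simp: descents_def)
        from elimination_descent_via_min[OF el u umin R'_def n(2)]
        show "x \<in> descents R' (Suc s) y \<union> descents R s u"
          using n(1) descentsI[of _ R' y x] descentsI[of _ R u x]
          by (meson Suc_le_mono UnI1 UnI2 le_trans)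
      qed
      have "card (descents R (Suc s) y) \<le> card (descents R' (Suc s) y \<union> descents R s u)"
        using cover 1 2 by (intro card_mono) auto
      also have "\<dots> \<le> card (descents R' (Suc s) y) + card (descents R s u)" by (rule card_Un_le)
      also have "\<dots> \<le> (Suc s + t choose t) + (s + Suc t choose Suc t)" using 1 2 by linarith
      also have "\<dots> = (Suc s + Suc t choose Suc t)" by simp
      finally show ?thesis using cover 1 2 finite_subset by blast
    qed
  qed
qed

section \<open>Rerouting descents and walks\<close>

lemma descent_reroute_step:
  assumes el: "elimination R" and "R c a" "(R ^^ m) c b" "b \<le> a"
  shows "\<exists>n\<le>m. (R ^^ n) a b"
  using assms(2-4)
proof (induction m arbitrary: c)
  case 0
  then show ?case using elimination_less[OF el] by fastforce
next
  case (Suc m)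
  from Suc.prems(2) obtain d where d: "R c d" "(R ^^ m) d b" by (blast dest: relpowp_Suc_D2)
  \<comment> \<open>\<open>a\<close> and the next vertex \<open>d\<close> are both out-neighbours of
    \<open>c\<close>. If \<open>d < a\<close>, the edge from \<open>a\<close> to \<open>d\<close>
    replaces the first edge; if \<open>a < d\<close>, then \<open>d\<close> takes the place of
    \<open>c\<close> with one step fewer.\<close>
  consider "d < a" | "d = a" | "a < d" by linarith
  then show ?case
  proof cases
    case 1
    then have "R a d" using elimination_clique[OF el d(1) Suc.prems(1)] by simp
    from relpowp_Suc_I2[of R, OF this d(2)] show ?thesis by blast
  next
    case 2
    then show ?thesis using d(2) le_SucI by blast
  next
    case 3
    then have "R d a" using elimination_clique[OF el Suc.prems(1) d(1)] by simp
    from Suc.IH[OF this d(2) Suc.prems(3)] show ?thesis using le_SucI by blast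
  qed
qed

text \<open>Each vertex on the way from \<open>c\<close> to \<open>a\<close> takes over the descent
  to \<open>b\<close> from its predecessor; all of them are at least \<open>a\<close>, hence at
  least \<open>b\<close>.\<close>

lemma descent_reroute:
  assumes el: "elimination R" and "R\<^sup>*\<^sup>* c a" "(R ^^ m) c b" "b \<le> a"
  shows "\<exists>n\<le>m. (R ^^ n) a b"
  using assms(2-4)
proof (induction rule: rtranclp_induct)
  case (step y z)
  have "b \<le> y" using elimination_less[OF el step(2)] step.prems by simp
  then obtain n where "n \<le> m" "(R ^^ n) y b" using step by blast
  then show ?case using descent_reroute_step[OF el step(2)] step.prems
    by (meson order_trans)
qed blast

text \<open>The descent is built from the end of the walk backwards: a falling step is prepended,
  and a rising step is absorbed by \<open>descent_reroute_step\<close>.\<close>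

lemma walk_to_min_descends:
  assumes el: "elimination R"
    and "((\<lambda>x y. (x = y \<or> R x y \<or> R y x) \<and> b \<le> x \<and> b \<le> y) ^^ n) a b"
  shows "\<exists>m\<le>n. (R ^^ m) a b"
  using assms(2)
proof (induction n arbitrary: a)
  case (Suc n)
  from Suc.prems obtain c where c: "a = c \<or> R a c \<or> R c a" "b \<le> a"
    "((\<lambda>x y. (x = y \<or> R x y \<or> R y x) \<and> b \<le> x \<and> b \<le> y) ^^ n) c b"
    by (blast dest: relpowp_Suc_D2)
  from Suc.IH[OF c(3)] obtain m where m: "m \<le> n" "(R ^^ m) c b" by blast
  from c(1) show ?case
  proof (elim disjE)
    assume "a = c"
    then show ?thesis using m le_SucI by blast
  next
    assume "R a c"
    then show ?thesis using m by (meson Suc_le_mono relpowp_Suc_I2)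
  next
    assume "R c a"
    from descent_reroute_step[OF el this m(2) c(2)] show ?thesis
      using m(1) by (meson le_SucI le_trans)
  qed
qed simp

section \<open>From tree decompositions to elimination orders\<close>

lemma treewidth_decomposition:
  assumes "graph H" "treewidth H \<le> t"
  shows "\<exists>T B. tree_decomposition H T B \<and> (\<forall>x\<in>verts T. card (B x) \<le> t + 1)"
proof -
  define P where "P w \<longleftrightarrow> (\<exists>T B. tree_decomposition H T B \<and> (\<forall>x\<in>verts T. card (B x) \<le> w + 1))"
    for w
  \<comment> \<open>One node whose bag is all of \<open>verts H\<close> shows that some width
    occurs, so the \<open>LEAST\<close> in \<open>treewidth\<close> is attained.\<close>
  let ?T = "({0}, \<lambda>_ _. False) :: nat graph"
  have T: "verts ?T = {0}" "\<not> adj ?T u v" for u v by (simp_all add: verts_def adj_def)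
  have "acyclic_graph ?T" unfolding acyclic_graph_def by (simp add: T)
  moreover have "graph ?T" unfolding graph_def by (simp add: T)
  moreover have c: "connected_on ?T {0}" unfolding connected_on_def by (simp add: T)
  ultimately have tree: "tree ?T" by (simp add: tree_def T(1))
  have "tree_decomposition H ?T (\<lambda>_. verts H)"
    unfolding tree_decomposition_def T(1) using tree c graph_adjD(1,2)[OF assms(1)] by simp
  then have "P (card (verts H))" unfolding P_def using T(1) by (metis le_add1)
  then have "P (treewidth H)" unfolding treewidth_def P_def[symmetric] by (rule LeastI)
  then show ?thesis unfolding P_def using assms(2) by (meson add_le_mono1 le_trans)
qed

text \<open>Vertices are ordered by the label of their top node, the least-labelled node whose bag
  holds them, and \<open>R\<close> leads from a vertex to the smaller vertices in its top bag. That
  bag has at most \<open>t + 1\<close> elements, one being the vertex itself.\<close>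

lemma treewidth_elimination:
  fixes H :: "'a graph"
  assumes "graph H" "treewidth H \<le> t"
  shows "\<exists>(\<rho> :: 'a \<Rightarrow> nat) R. inj_on \<rho> (verts H) \<and> elimination R \<and>
    (\<forall>y x. R y x \<longrightarrow> y \<in> \<rho> ` verts H \<and> x \<in> \<rho> ` verts H) \<and>
    (\<forall>y. card {x. R y x} \<le> t) \<and>
    (\<forall>u v. adj H u v \<longrightarrow> R (\<rho> u) (\<rho> v) \<or> R (\<rho> v) (\<rho> u))"
proof -
  obtain T B where TB: "tree_decomposition H T B" and width: "\<forall>x\<in>verts T. card (B x) \<le> t + 1"
    using treewidth_decomposition[OF assms] by blast
  have tree: "tree T" and BV: "\<And>x. x \<in> verts T \<Longrightarrow> B x \<subseteq> verts H"
    and Bv: "\<And>v. v \<in> verts H \<Longrightarrow> \<exists>x\<in>verts T. v \<in> B x"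
    and Be: "\<And>u v. adj H u v \<Longrightarrow> \<exists>x\<in>verts T. u \<in> B x \<and> v \<in> B x"
    and Bc: "\<And>v. v \<in> verts H \<Longrightarrow> connected_on T {x \<in> verts T. v \<in> B x}"
    using TB by (auto simp: tree_decomposition_def)
  have gT: "graph T" "finite (verts T)" using tree by (auto simp: tree_def graph_def)
  have finV: "finite (verts H)" using assms(1) by (auto simp: graph_def)
  obtain f :: "nat \<Rightarrow> nat" where f: "inj_on f (verts T)"
    and funiq: "\<And>x y z. adj T x y \<Longrightarrow> adj T x z \<Longrightarrow> f y < f x \<Longrightarrow> f z < f x \<Longrightarrow> y = z"
    using tree_rooting[OF tree] by metis
  define \<tau> where "\<tau> v = Min (f ` {x \<in> verts T. v \<in> B x})" for v
  have top: "\<exists>i\<in>verts T. v \<in> B i \<and> f i = \<tau> v" if "v \<in> verts H" for v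
  proof -
    have "\<tau> v \<in> f ` {x \<in> verts T. v \<in> B x}"
      unfolding \<tau>_def by (rule Min_in) (use gT Bv[OF that] in auto)
    then show ?thesis by auto
  qed
  have top_le: "\<tau> v \<le> f i" if "i \<in> verts T" "v \<in> B i" for v i
    unfolding \<tau>_def by (rule Min_le) (use gT that in auto)
  \<comment> \<open>While the label of \<open>i\<close> exceeds \<open>\<tau> b\<close>, the nodes
    holding \<open>a\<close> and those holding \<open>b\<close> both contain the parent of
    \<open>i\<close>, so the common bag moves up until it is the top bag of
    \<open>b\<close>.\<close>
  have share: "a \<in> B j"
    if "i \<in> verts T" "a \<in> B i" "b \<in> B i" "j \<in> verts T" "b \<in> B j" "f j = \<tau> b" "\<tau> a \<le> \<tau> b" for i j a b
    using that
  proof (induction "f i" arbitrary: i rule: less_induct)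
    case less
    have ab: "a \<in> verts H" "b \<in> verts H" using BV less.prems by auto
    show ?case
    proof (cases "f i = \<tau> b")
      case True
      then have "i = j" using f less.prems by (metis inj_on_eq_iff)
      then show ?thesis using less.prems by simp
    next
      case False
      then have lt: "\<tau> b < f i" using top_le less.prems le_neq_implies_less by metis
      obtain m where m: "m \<in> verts T" "a \<in> B m" "f m = \<tau> a" using top[OF ab(1)] by blast
      have "\<exists>k\<in>{x \<in> verts T. a \<in> B x}. adj T i k \<and> f k < f i"
        by (rule connected_on_ascend[OF gT(1) f funiq Bc[OF ab(1)], where i = i and m = m])
          (use m lt less.prems in auto)
      moreover have "\<exists>k\<in>{x \<in> verts T. b \<in> B x}. adj T i k \<and> f k < f i"
        by (rule connected_on_ascend[OF gT(1) f funiq Bc[OF ab(2)], where i = i and m = j])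
          (use lt less.prems in auto)
      ultimately obtain k where "k \<in> verts T" "a \<in> B k" "b \<in> B k" "f k < f i"
        using funiq by blast
      then show ?thesis using less.hyps less.prems by blast
    qed
  qed
  obtain idx :: "'a \<Rightarrow> nat" and N where idx: "idx ` verts H = {i. i < N}" "inj_on idx (verts H)"
    using finite_imp_inj_to_nat_seg[OF finV] by blast
  have idx_less: "idx v < N" if "v \<in> verts H" for v using idx(1) that by blast
  \<comment> \<open>Lexicographic order on \<open>(\<tau> v, idx v)\<close> coded in one number, as
    \<open>idx v < N\<close>; \<open>idx\<close> only breaks ties.\<close>
  define \<rho> where "\<rho> v = \<tau> v * N + idx v" for v
  have inj: "inj_on \<rho> (verts H)"
  proof (rule inj_onI)
    fix u v assume uv: "u \<in> verts H" "v \<in> verts H" "\<rho> u = \<rho> v"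
    have "\<rho> w mod N = idx w" if "w \<in> verts H" for w using idx_less[OF that] by (simp add: \<rho>_def)
    then have "idx u = idx v" using uv by metis
    then show "u = v" using idx(2) uv by (meson inj_onD)
  qed
  have \<tau>_le: "\<tau> u \<le> \<tau> v" if "v \<in> verts H" "\<rho> u < \<rho> v" for u v
  proof (rule ccontr)
    assume "\<not> \<tau> u \<le> \<tau> v"
    then have "Suc (\<tau> v) * N \<le> \<tau> u * N" by (intro mult_le_mono1) simp
    then show False using that idx_less[OF that(1)] by (simp add: \<rho>_def)
  qed
  define R where "R n m \<longleftrightarrow> (\<exists>u\<in>verts H. \<exists>v\<in>verts H. n = \<rho> v \<and> m = \<rho> u \<and> \<rho> u < \<rho> v \<and>
    (\<exists>i\<in>verts T. v \<in> B i \<and> f i = \<tau> v \<and> u \<in> B i))" for n m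
  \<comment> \<open>Any two vertices sharing a bag become related. This yields both the clique
    condition and the edges of \<open>H\<close>.\<close>
  have RI: "R (\<rho> v) (\<rho> u)" if "i \<in> verts T" "u \<in> B i" "v \<in> B i" "\<rho> u < \<rho> v" for u v i
  proof -
    have uv: "u \<in> verts H" "v \<in> verts H" using BV that by auto
    obtain j where j: "j \<in> verts T" "v \<in> B j" "f j = \<tau> v" using top[OF uv(2)] by blast
    have "u \<in> B j" by (rule share[OF that(1-3) j \<tau>_le[OF uv(2) that(4)]])
    then show ?thesis using uv j that(4) unfolding R_def by blast
  qed
  have "elimination R"
    unfolding elimination_def
  proof (intro conjI allI impI)
    show "x < y" if "R y x" for x y using that unfolding R_def by blast
    show "R b a" if "R z a \<and> R z b \<and> a < b" for z a b
    proof -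
      from that obtain u v i where 1: "v \<in> verts H" "u \<in> verts H" "z = \<rho> v" "a = \<rho> u"
        "i \<in> verts T" "f i = \<tau> v" "u \<in> B i" unfolding R_def by blast
      from that obtain u' v' i' where 2: "v' \<in> verts H" "z = \<rho> v'" "b = \<rho> u'"
        "i' \<in> verts T" "f i' = \<tau> v'" "u' \<in> B i'" unfolding R_def by blast
      have "v = v'" using inj 1 2 by (metis inj_onD)
      then have "i = i'" using f 1 2 by (metis inj_onD)
      then show ?thesis using RI[of i u u'] 1 2 that by simp
    qed
  qed
  moreover have "card {x. R y x} \<le> t" for y
  proof (cases "\<exists>v\<in>verts H. y = \<rho> v")
    case True
    then obtain v where v: "v \<in> verts H" "y = \<rho> v" by blast
    obtain i where i: "i \<in> verts T" "v \<in> B i" "f i = \<tau> v" using top[OF v(1)] by blast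
    have fin: "finite (B i)" using BV[OF i(1)] finV finite_subset by blast
    have "{x. R y x} \<subseteq> \<rho> ` (B i - {v})"
    proof
      fix x assume "x \<in> {x. R y x}"
      then obtain u v' i' where u: "v' \<in> verts H" "y = \<rho> v'" "x = \<rho> u" "\<rho> u < \<rho> v'"
        "i' \<in> verts T" "f i' = \<tau> v'" "u \<in> B i'" unfolding R_def by blast
      have "v = v'" using inj v u by (metis inj_onD)
      then have "i = i'" using f i u by (metis inj_onD)
      then show "x \<in> \<rho> ` (B i - {v})" using u \<open>v = v'\<close> by auto
    qed
    then have "card {x. R y x} \<le> card (B i - {v})"
      using fin by (meson surj_card_le finite_Diff)
    also have "\<dots> \<le> t"
    proof -
      have "card (B i) \<le> Suc t" using width i(1) by fastforce
      then show ?thesis using fin i(2) by (simp add: card_Diff_singleton)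
    qed
    finally show ?thesis .
  next
    case False
    then have "{x. R y x} = {}" unfolding R_def by blast
    then show ?thesis by simp
  qed
  moreover have "R (\<rho> u) (\<rho> v) \<or> R (\<rho> v) (\<rho> u)" if "adj H u v" for u v
  proof -
    note uv = graph_adjD[OF assms(1) that]
    from Be[OF that] obtain i where i: "i \<in> verts T" "u \<in> B i" "v \<in> B i" by blast
    have "\<rho> u \<noteq> \<rho> v" using inj uv by (meson inj_onD)
    then show ?thesis using RI i by (meson nat_neq_iff)
  qed
  moreover have "y \<in> \<rho> ` verts H \<and> x \<in> \<rho> ` verts H" if "R y x" for x y
    using that unfolding R_def by blast
  ultimately show ?thesis using inj by (intro exI[of _ \<rho>] exI[of _ R]) blast
qed

section \<open>Tree decompositions from elimination orders\<close>

text \<open>Parents have smaller numbers, so following them leads to 0. On a cycle, both cyclic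
  neighbours of the greatest node would be its parent.\<close>

lemma tree_of_parents:
  fixes q :: "nat \<Rightarrow> nat" and M :: nat
  assumes q: "\<And>i. 0 < i \<Longrightarrow> q i < i"
  defines "T \<equiv> ({..M}, \<lambda>i j. i \<le> M \<and> j \<le> M \<and> (0 < i \<and> j = q i \<or> 0 < j \<and> i = q j))"
  shows "tree T"
proof -
  have T: "verts T = {..M}"
    "\<And>i j. adj T i j \<longleftrightarrow> i \<le> M \<and> j \<le> M \<and> (0 < i \<and> j = q i \<or> 0 < j \<and> i = q j)"
    by (simp_all add: T_def verts_def adj_def)
  have g: "graph T"
  proof -
    have "i \<noteq> q i" if "0 < i" for i using q[OF that] by simp
    then show ?thesis unfolding graph_def T by (simp, blast)
  qed
  have "(adj_in T {..M})\<^sup>*\<^sup>* i 0" if "i \<le> M" for i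
    using that
  proof (induction i rule: less_induct)
    case (less i)
    show ?case
    proof (cases "i = 0")
      case False
      then have "q i < i" using q by simp
      then have "(adj_in T {..M})\<^sup>*\<^sup>* (q i) 0" "adj_in T {..M} i (q i)"
        using less False by (auto simp: adj_in_def T)
      then show ?thesis by (rule converse_rtranclp_into_rtranclp[rotated])
    qed simp
  qed
  then have c: "connected_on T {..M}"
    using connected_on_star[OF g, of "{..M}" 0] T(1) by auto
  have down: "b = q a" if "adj T a b" "b < a" for a b
    using that q[of b] by (auto simp: T(2))
  have "acyclic_graph T"
    unfolding acyclic_graph_def
  proof clarify
    fix xs assume len: "3 \<le> length xs" and d: "distinct xs"
      and p: "\<forall>i. Suc i < length xs \<longrightarrow> adj T (xs ! i) (xs ! Suc i)"
      and l: "adj T (last xs) (hd xs)"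
    let ?n = "length xs"
    define nx where "nx i = (if Suc i < ?n then Suc i else 0)" for i
    have ne: "xs \<noteq> []" using len by auto
    have step: "adj T (xs ! i) (xs ! nx i)" if "i < ?n" for i
    proof (cases "Suc i < ?n")
      case False
      then have "i = ?n - 1" using that by simp
      then show ?thesis using l ne False by (simp add: nx_def last_conv_nth hd_conv_nth)
    qed (use p in \<open>simp add: nx_def\<close>)
    obtain i where i: "i < ?n" "xs ! i = Max (set xs)"
      using Max_in[of "set xs"] ne by (auto simp: in_set_conv_nth)
    have below: "xs ! j < xs ! i" if "j < ?n" "j \<noteq> i" for j
    proof -
      have "xs ! j \<le> xs ! i" unfolding i(2) using that by simp
      moreover have "xs ! j \<noteq> xs ! i" using d that i(1) by (simp add: nth_eq_iff_index_eq)
      ultimately show ?thesis by simp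
    qed
    \<comment> \<open>\<open>j\<close> is the cyclic predecessor of \<open>i\<close>; length at
      least 3 keeps it apart from the successor \<open>nx i\<close>.\<close>
    obtain j where j: "j < ?n" "nx j = i" "j \<noteq> i" "j \<noteq> nx i"
    proof (cases i)
      case 0
      show ?thesis by (rule that[of "?n - 1"]) (use len 0 in \<open>auto simp: nx_def\<close>)
    next
      case (Suc i')
      show ?thesis by (rule that[of i']) (use len Suc i in \<open>auto simp: nx_def\<close>)
    qed
    have n: "nx i < ?n" "nx i \<noteq> i" using len i(1) by (auto simp: nx_def)
    have "xs ! nx i = q (xs ! i)" using down step[OF i(1)] below n by blast
    moreover have "xs ! j = q (xs ! i)"
      using down graph_adjD(4)[OF g step[OF j(1)]] below j by metis
    ultimately show False using d j n by (metis nth_eq_iff_index_eq)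
  qed
  then show ?thesis using g c T(1) by (simp add: tree_def)
qed

lemma treewidth_le:
  assumes "tree_decomposition G T B" "\<And>x. x \<in> verts T \<Longrightarrow> card (B x) \<le> w + 1"
  shows "treewidth G \<le> w"
  unfolding treewidth_def by (rule Least_le) (use assms in blast)

text \<open>Bags are the descent sets, so adjacent vertices meet in the bag of one of them and
  \<open>card_descents\<close> bounds the width. Hanging each node below that of the greatest
  out-neighbour connects every node whose bag holds \<open>x\<close> to the node of
  \<open>x\<close>.\<close>

lemma treewidth_descents:
  fixes V :: "nat set" and s :: nat
  assumes el: "elimination R" and fin: "finite V"
    and RV: "\<And>y x. R y x \<Longrightarrow> y \<in> V \<and> x \<in> V"
    and deg: "\<And>y. card {x. R y x} \<le> t"
  defines "J \<equiv> (V, \<lambda>x y. x \<in> V \<and> y \<in> V \<and> x \<noteq> y \<and> (x \<in> descents R s y \<or> y \<in> descents R s x))"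
  shows "graph J" and "treewidth J \<le> (s + t choose t) - 1"
proof -
  have J: "verts J = V" "\<And>x y. adj J x y \<longleftrightarrow> x \<in> V \<and> y \<in> V \<and> x \<noteq> y \<and>
    (x \<in> descents R s y \<or> y \<in> descents R s x)"
    by (simp_all add: J_def verts_def adj_def)
  show "graph J" unfolding graph_def J using fin by blast
  have finR: "finite {x. R y x}" for y using RV fin by (metis finite_subset mem_Collect_eq subsetI)
  have descV: "descents R s y \<subseteq> V" if "y \<in> V" for y
  proof -
    have "x \<in> V" if "(R ^^ n) y x" for n x
      using that \<open>y \<in> V\<close> RV by (cases n) auto
    then show ?thesis by (auto simp: descents_def)
  qed
  \<comment> \<open>node \<open>Suc y\<close> stands for the vertex \<open>y\<close>; node 0 is an extra root with an empty bag\<close>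
  define q where "q i = (if {x. R (i - 1) x} = {} then 0 else Suc (Max {x. R (i - 1) x}))" for i
  have q_less: "q i < i" if "0 < i" for i
  proof (cases "{x. R (i - 1) x} = {}")
    case False
    then have "R (i - 1) (Max {x. R (i - 1) x})" using Max_in[OF finR False] by simp
    from elimination_less[OF el this] have "Suc (Max {x. R (i - 1) x}) < Suc (i - 1)" by simp
    then show ?thesis unfolding q_def using that False by simp
  qed (use that in \<open>simp add: q_def\<close>)
  \<comment> \<open>\<open>insert 0\<close> keeps \<open>Max\<close> meaningful when
    \<open>V\<close> is empty.\<close>
  define M where "M = Suc (Max (insert 0 V))"
  have VM: "Suc y \<le> M" if "y \<in> V" for y using that fin by (simp add: M_def)
  define T where "T = ({..M}, \<lambda>i j. i \<le> M \<and> j \<le> M \<and> (0 < i \<and> j = q i \<or> 0 < j \<and> i = q j))"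
  have T: "verts T = {..M}"
    "\<And>i j. adj T i j \<longleftrightarrow> i \<le> M \<and> j \<le> M \<and> (0 < i \<and> j = q i \<or> 0 < j \<and> i = q j)"
    by (simp_all add: T_def verts_def adj_def)
  have tree: "tree T" unfolding T_def by (rule tree_of_parents[OF q_less])
  then have gT: "graph T" by (simp add: tree_def)
  define B where "B i = (if 0 < i \<and> i - 1 \<in> V then descents R s (i - 1) else {})" for i
  \<comment> \<open>A descent that leaves \<open>y\<close> for \<open>w\<close> can start at the
    greatest out-neighbour \<open>z\<close> instead: either \<open>w = z\<close>, or the clique
    gives an edge from \<open>z\<close> to \<open>w\<close> that replaces the one from
    \<open>y\<close>.\<close>
  have parent: "\<exists>z. R y z \<and> z \<in> V \<and> q (Suc y) = Suc z \<and> x \<in> descents R s z"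
    if "x \<in> descents R s y" "x \<noteq> y" for x y
  proof -
    from that(1) obtain n where n: "n \<le> s" "(R ^^ n) y x" by (auto simp: descents_def)
    then have "n \<noteq> 0" using that(2) by (metis relpowp_0_E)
    then obtain m where m: "n = Suc m" using not0_implies_Suc by blast
    then obtain w where w: "R y w" "(R ^^ m) w x" using n(2) by (meson relpowp_Suc_D2)
    then have ne: "{x. R y x} \<noteq> {}" by blast
    define z where "z = Max {x. R y x}"
    have z: "R y z" using Max_in[OF finR ne] by (simp add: z_def)
    have wz: "w \<le> z" unfolding z_def by (rule Max_ge[OF finR]) (use w in simp)
    have "\<exists>k\<le>Suc m. (R ^^ k) z x"
    proof (cases "w = z")
      case True
      then show ?thesis using w(2) le_SucI by blast
    next
      case False
      then have "R z w" using elimination_clique[OF el w(1) z] wz by simp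
      then show ?thesis using relpowp_Suc_I2[of R z w m x] w(2) by blast
    qed
    then have "x \<in> descents R s z" unfolding descents_def using n(1) m by (blast intro: order_trans)
    then show ?thesis using z RV ne by (auto simp: q_def z_def)
  qed
  have "tree_decomposition J T B"
    unfolding tree_decomposition_def J(1)
  proof (intro conjI ballI allI impI)
    show "tree T" by (rule tree)
    show "B i \<subseteq> V" for i using descV by (auto simp: B_def)
    show "\<exists>i\<in>verts T. v \<in> B i" if "v \<in> V" for v
      by (rule bexI[of _ "Suc v"]) (use that VM self_in_descents in \<open>auto simp: B_def T(1)\<close>)
    show "\<exists>i\<in>verts T. u \<in> B i \<and> v \<in> B i" if "adj J u v" for u v
    proof -
      from that have uv: "u \<in> V" "v \<in> V" "u \<in> descents R s v \<or> v \<in> descents R s u"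
        by (simp_all add: J(2))
      have "Suc u \<in> verts T" "Suc v \<in> verts T" using VM uv by (simp_all add: T(1))
      moreover have "B (Suc u) = descents R s u" "B (Suc v) = descents R s v"
        using uv by (simp_all add: B_def)
      ultimately show ?thesis using uv(3) self_in_descents by metis
    qed
    show "connected_on T {i \<in> verts T. x \<in> B i}" if x: "x \<in> V" for x
    proof (rule connected_on_star[OF gT, of _ "Suc x"])
      let ?S = "{i \<in> verts T. x \<in> B i}"
      have S: "Suc y \<in> ?S \<longleftrightarrow> y \<in> V \<and> x \<in> descents R s y" for y
        using VM by (auto simp: B_def T(1))
      have reach: "(adj_in T ?S)\<^sup>*\<^sup>* (Suc y) (Suc x)" if "Suc y \<in> ?S" for y
        using that
      proof (induction y rule: less_induct)
        case (less y)
        show ?case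
        proof (cases "x = y")
          case False
          have y: "y \<in> V" "x \<in> descents R s y" using less.prems S by auto
          obtain z where z: "R y z" "z \<in> V" "q (Suc y) = Suc z" "x \<in> descents R s z"
            using parent[OF y(2) False] by blast
          have "Suc z \<in> ?S" using S z by simp
          moreover have "adj T (Suc y) (Suc z)" unfolding T(2) using VM y z by simp
          ultimately have "adj_in T ?S (Suc y) (Suc z)" using less.prems by (simp add: adj_in_def)
          moreover have "(adj_in T ?S)\<^sup>*\<^sup>* (Suc z) (Suc x)"
            by (rule less.IH[OF elimination_less[OF el z(1)] \<open>Suc z \<in> ?S\<close>])
          ultimately show ?thesis by (rule converse_rtranclp_into_rtranclp)
        qed simp
      qed
      show "(adj_in T ?S)\<^sup>*\<^sup>* i (Suc x)" if "i \<in> ?S" for i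
      proof -
        have "i \<noteq> 0" using that by (auto simp: B_def split: if_splits)
        then obtain y where "i = Suc y" using not0_implies_Suc by blast
        then show ?thesis using reach that by blast
      qed
      show "Suc x \<in> ?S" using S x self_in_descents by blast
    qed blast
  qed
  moreover have "card (B i) \<le> (s + t choose t) - 1 + 1" for i
  proof -
    \<comment> \<open>Positivity makes the truncated subtraction and the added 1 cancel.\<close>
    have "0 < (s + t choose t)" by (subst zero_less_binomial_iff) simp
    moreover have "card (descents R s y) \<le> (s + t choose t)" for y
      using card_descents[OF el, of y t s] finR deg by blast
    ultimately show ?thesis by (auto simp: B_def)
  qed
  ultimately show "treewidth J \<le> (s + t choose t) - 1" by (rule treewidth_le)
qed

section \<open>Embedding a shallow minor\<close>

text \<open>Each fibre of \<open>key\<close> is numbered separately; the number will be the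
  coordinate in the complete graph.\<close>

lemma fibre_indexing:
  assumes "finite A" "\<And>k. card {v \<in> A. key v = k} \<le> N"
  shows "\<exists>g :: 'a \<Rightarrow> nat. (\<forall>v\<in>A. g v < N) \<and> inj_on (\<lambda>v. (key v, g v)) A"
proof -
  have "\<exists>g :: 'a \<Rightarrow> nat. inj_on g {v \<in> A. key v = k} \<and> g ` {v \<in> A. key v = k} \<subseteq> {..<N}" for k
  proof -
    have "finite {v \<in> A. key v = k}" using assms(1) by simp
    then obtain g :: "'a \<Rightarrow> nat" where "bij_betw g {v \<in> A. key v = k} {0..<card {v \<in> A. key v = k}}"
      using ex_bij_betw_finite_nat by blast
    then have "inj_on g {v \<in> A. key v = k}" "g ` {v \<in> A. key v = k} \<subseteq> {..<N}"
      using assms(2)[of k] by (auto simp: bij_betw_def)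
    then show ?thesis by blast
  qed
  then obtain g :: "'b \<Rightarrow> 'a \<Rightarrow> nat" where
    g: "\<And>k. inj_on (g k) {v \<in> A. key v = k}" "\<And>k. g k ` {v \<in> A. key v = k} \<subseteq> {..<N}"
    by metis
  have "inj_on (\<lambda>v. (key v, g (key v) v)) A"
    using g(1) by (auto simp: inj_on_def)
  moreover have "g (key v) v < N" if "v \<in> A" for v
    using g(2)[of "key v"] that by blast
  ultimately show ?thesis by (intro exI[of _ "\<lambda>v. g (key v) v"]) blast
qed

text \<open>The walk from \<open>q\<close> over \<open>p\<close> to \<open>x\<close> stays at or
  above \<open>x\<close>, so it yields a descent from \<open>q\<close>. The walk in \<open>Q\<close>
  yields a descent from \<open>q\<close> to \<open>y\<close>, along which the first one is rerouted.
  Hence the bound counts only the walk in \<open>P\<close> and the joining step.\<close>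

lemma touching_sets_descend:
  assumes el: "elimination R"
    and P: "((\<lambda>a b. (a = b \<or> R a b \<or> R b a) \<and> a \<in> P \<and> b \<in> P) ^^ n) p x" "\<And>a. a \<in> P \<Longrightarrow> x \<le> a"
    and Q: "((\<lambda>a b. (a = b \<or> R a b \<or> R b a) \<and> a \<in> Q \<and> b \<in> Q) ^^ m) q y" "\<And>a. a \<in> Q \<Longrightarrow> y \<le> a"
    and "p \<in> P" "q \<in> Q" "p = q \<or> R p q \<or> R q p" "x \<le> y"
  shows "x \<in> descents R (Suc n) y"
proof -
  let ?W = "\<lambda>c a b. (a = b \<or> R a b \<or> R b a) \<and> c \<le> a \<and> c \<le> b"
  have "((?W x) ^^ n) p x" using relpowp_map[OF P(1), of "?W x" id] P(2) by simp
  moreover have "?W x q p" using assms(6-9) P(2)[of p] Q(2)[of q] by auto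
  ultimately have "((?W x) ^^ Suc n) q x" by (rule relpowp_Suc_I2[rotated])
  from walk_to_min_descends[OF el this] obtain k where k: "k \<le> Suc n" "(R ^^ k) q x" by blast
  have "((?W y) ^^ m) q y" using relpowp_map[OF Q(1), of "?W y" id] Q(2) by simp
  from walk_to_min_descends[OF el this] have "R\<^sup>*\<^sup>* q y" by (blast dest: relpowp_imp_rtranclp)
  from descent_reroute[OF el this k(2) \<open>x \<le> y\<close>] k(1) show ?thesis
    by (meson descentsI order_trans)
qed

text \<open>Closed neighbourhoods are counted because a branch set may meet the fibre over its
  minimum at the centre's own \<open>L\<close>-coordinate; this is the source of
  \<open>k + 1\<close>.\<close>

lemma card_graph_power_neighbourhood:
  assumes "graph L" "y \<in> verts L" "max_degree (graph_power L r) \<le> k"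
  shows "finite (insert y {u. adj (graph_power L r) y u})"
    and "card (insert y {u. adj (graph_power L r) y u}) \<le> k + 1"
proof -
  have fin: "finite (verts L)" using assms(1) by (simp add: graph_def)
  let ?N = "\<lambda>v. {u \<in> verts L. adj (graph_power L r) v u}"
  have eq: "{u. adj (graph_power L r) y u} = ?N y" by (auto simp: adj_graph_power)
  have "card (?N y) \<le> Max ((\<lambda>v. card (?N v)) ` verts L)" using fin assms(2) by simp
  also have "\<dots> = max_degree (graph_power L r)" using assms(2) by (auto simp: max_degree_def)
  also have "\<dots> \<le> k" by (rule assms(3))
  finally show "card (insert y {u. adj (graph_power L r) y u}) \<le> k + 1"
    unfolding eq using card_insert_le_m1[of "k + 1" "?N y" y] by simp
  show "finite (insert y {u. adj (graph_power L r) y u})" unfolding eq using fin by simp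
qed

theorem theorem7:
  fixes r t k l :: nat and H :: "'a graph" and L :: "'b graph" and G :: "'c graph"
  assumes "l \<ge> 1" and "graph H" and "graph L" and "graph G"
    and "treewidth H \<le> t"
    and "max_degree (graph_power L r) \<le> k"
    and "shallow_minor r G (strong_prod (strong_prod H L) (complete_graph l))"
  shows "\<exists>J :: nat graph. graph J \<and> treewidth J \<le> ((2 * r + 1 + t) choose t) - 1 \<and>
           contained_in G (strong_prod (strong_prod J (graph_power L (2 * r + 1)))
                                       (complete_graph (l * (k + 1))))"
proof -
  obtain \<rho> :: "'a \<Rightarrow> nat" and R where inj: "inj_on \<rho> (verts H)" and el: "elimination R"
    and RV: "\<And>y x. R y x \<Longrightarrow> y \<in> \<rho> ` verts H \<and> x \<in> \<rho> ` verts H"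
    and deg: "\<And>y. card {x. R y x} \<le> t"
    and RH: "\<And>u v. adj H u v \<Longrightarrow> R (\<rho> u) (\<rho> v) \<or> R (\<rho> v) (\<rho> u)"
    using treewidth_elimination[OF assms(2,5)] by metis
  have finH: "finite (\<rho> ` verts H)" using assms(2) by (simp add: graph_def)
  define J where "J = (\<rho> ` verts H, \<lambda>x y. x \<in> \<rho> ` verts H \<and> y \<in> \<rho> ` verts H \<and> x \<noteq> y \<and>
    (x \<in> descents R (2 * r + 1) y \<or> y \<in> descents R (2 * r + 1) x))"
  have gJ: "graph J" and tJ: "treewidth J \<le> (2 * r + 1 + t choose t) - 1"
    unfolding J_def by (rule treewidth_descents[OF el finH RV deg]; assumption)+
  have J: "verts J = \<rho> ` verts H" "\<And>x y. adj J x y \<longleftrightarrow> x \<in> \<rho> ` verts H \<and> y \<in> \<rho> ` verts H \<and>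
    x \<noteq> y \<and> (x \<in> descents R (2 * r + 1) y \<or> y \<in> descents R (2 * r + 1) x)"
    by (simp_all add: J_def verts_def adj_def)
  define W where "W = strong_prod (strong_prod H L) (complete_graph l)"
  have gW: "graph W"
    unfolding W_def using assms(2,3) by (intro graph_strong_prod graph_complete_graph)
  have finW: "finite (verts W)" using gW by (simp add: graph_def)
  have vW: "verts W = (verts H \<times> verts L) \<times> {0..<l}" by (simp add: W_def)
  obtain \<mu> where
    conn: "\<And>v. v \<in> verts G \<Longrightarrow> connected_on W (\<mu> v)" and
    rad: "\<And>v. v \<in> verts G \<Longrightarrow> radius_le W (\<mu> v) r" and
    disj: "\<And>v w. v \<in> verts G \<Longrightarrow> w \<in> verts G \<Longrightarrow> v \<noteq> w \<Longrightarrow> \<mu> v \<inter> \<mu> w = {}" and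
    edge: "\<And>v w. adj G v w \<Longrightarrow> \<exists>x\<in>\<mu> v. \<exists>y\<in>\<mu> w. adj W x y"
    using assms(7) unfolding shallow_minor_def W_def[symmetric] by metis
  have \<mu>W: "\<mu> v \<subseteq> verts W" "\<mu> v \<noteq> {}" if "v \<in> verts G" for v
    using conn[OF that] by (auto simp: connected_on_def)
  have "\<forall>v\<in>verts G. \<exists>c. c \<in> \<mu> v \<and> (\<forall>x\<in>\<mu> v. \<exists>n\<le>r. (adj_in W (\<mu> v) ^^ n) c x)"
    using rad unfolding radius_le_def by blast
  then obtain c where c: "\<And>v. v \<in> verts G \<Longrightarrow> c v \<in> \<mu> v"
    "\<And>v x. v \<in> verts G \<Longrightarrow> x \<in> \<mu> v \<Longrightarrow> \<exists>n\<le>r. (adj_in W (\<mu> v) ^^ n) (c v) x"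
    by metis
  have adj_in_sym: "adj_in W S y x" if "adj_in W S x y" for S x y
    using that graph_adjD(4)[OF gW] by (auto simp: adj_in_def)
  have diam: "\<exists>n\<le>2 * r. (adj_in W (\<mu> v) ^^ n) x y"
    if "v \<in> verts G" "x \<in> \<mu> v" "y \<in> \<mu> v" for v x y
  proof -
    from c(2)[OF that(1,2)] c(2)[OF that(1,3)]
    obtain m n where mn: "m \<le> r" "(adj_in W (\<mu> v) ^^ m) (c v) x"
      "n \<le> r" "(adj_in W (\<mu> v) ^^ n) (c v) y" by blast
    have "(adj_in W (\<mu> v) ^^ (m + n)) x y"
      using relpowp_trans[OF relpowp_sym[OF mn(2) adj_in_sym] mn(4)] .
    then show ?thesis using mn(1,3) by (intro exI[of _ "m + n"]) simp
  qed
  define \<eta> where "\<eta> p = \<rho> (fst (fst p))" for p :: "('a \<times> 'b) \<times> nat"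
  define \<beta> where "\<beta> p = snd (fst p)" for p :: "('a \<times> 'b) \<times> nat"
  have W_adj: "fst (fst p) = fst (fst q) \<or> adj H (fst (fst p)) (fst (fst q))"
    "\<beta> p = \<beta> q \<or> adj L (\<beta> p) (\<beta> q)" if "adj W p q" for p q
    using that unfolding W_def \<beta>_def
    by (auto simp: adj_strong_prod[OF graph_complete_graph] adj_strong_prod[OF assms(3)])
  have \<eta>_adj: "\<eta> p = \<eta> q \<or> R (\<eta> p) (\<eta> q) \<or> R (\<eta> q) (\<eta> p)" if "adj W p q" for p q
    using W_adj(1)[OF that] RH unfolding \<eta>_def by metis
  \<comment> \<open>The two coordinates follow different rules: descents end at minima, whereas the
    centre is within \<open>r\<close> of its whole branch set and so keeps distances in
    \<open>L\<close> short.\<close>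
  define h where "h v = Min (\<eta> ` \<mu> v)" for v
  define b where "b v = \<beta> (c v)" for v
  have fin\<mu>: "finite (\<eta> ` \<mu> v)" if "v \<in> verts G" for v
    using \<mu>W[OF that] finW finite_subset by blast
  have h_le: "h v \<le> a" if "v \<in> verts G" "a \<in> \<eta> ` \<mu> v" for v a
    unfolding h_def using fin\<mu> that by simp
  have "\<exists>w. w \<in> \<mu> v \<and> \<eta> w = h v" if "v \<in> verts G" for v
  proof -
    have "h v \<in> \<eta> ` \<mu> v" unfolding h_def using fin\<mu> \<mu>W that by simp
    then show ?thesis by (metis imageE)
  qed
  then obtain w where w: "\<And>v. v \<in> verts G \<Longrightarrow> w v \<in> \<mu> v" "\<And>v. v \<in> verts G \<Longrightarrow> \<eta> (w v) = h v"
    by metis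
  have wH: "fst (fst (w v)) \<in> verts H" "\<beta> (w v) \<in> verts L" "snd (w v) < l" if "v \<in> verts G" for v
    using w(1)[OF that] \<mu>W(1)[OF that] by (auto simp: vW \<beta>_def)
  have hJ: "h v \<in> verts J" if "v \<in> verts G" for v
    unfolding J(1) using wH(1)[OF that] w(2)[OF that] unfolding \<eta>_def by (metis imageI)
  have bL: "b v \<in> verts L" if "v \<in> verts G" for v
    using c(1)[OF that] \<mu>W(1)[OF that] by (auto simp: vW \<beta>_def b_def)

  \<comment> \<open>At most \<open>2 * r\<close> steps lead inside the branch set of
    \<open>v\<close> from the end \<open>p\<close> of the joining edge to \<open>w v\<close>; that
    edge adds the last one.\<close>
  have descend: "h v \<in> descents R (2 * r + 1) (h u)" if "adj G u v" "h v \<le> h u" for u v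
  proof -
    note uv = graph_adjD[OF assms(4) that(1)]
    from edge[OF that(1)] obtain q p where pq: "q \<in> \<mu> u" "p \<in> \<mu> v" "adj W q p" by blast
    obtain n where n: "n \<le> 2 * r" "(adj_in W (\<mu> v) ^^ n) p (w v)"
      using diam[OF uv(2) pq(2) w(1)[OF uv(2)]] by blast
    obtain m where m: "(adj_in W (\<mu> u) ^^ m) q (w u)"
      using diam[OF uv(1) pq(1) w(1)[OF uv(1)]] by blast
    let ?Z = "\<lambda>P a b. (a = b \<or> R a b \<or> R b a) \<and> a \<in> P \<and> b \<in> P"
    have Z: "?Z (\<eta> ` \<mu> x) (\<eta> a) (\<eta> b)" if "adj_in W (\<mu> x) a b" for x a b
      using that \<eta>_adj by (auto simp: adj_in_def)
    have "h v \<in> descents R (Suc n) (h u)"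
    proof (rule touching_sets_descend[OF el, where P = "\<eta> ` \<mu> v" and Q = "\<eta> ` \<mu> u"])
      show "(?Z (\<eta> ` \<mu> v) ^^ n) (\<eta> p) (h v)"
        using relpowp_map[OF n(2), of "?Z (\<eta> ` \<mu> v)" \<eta>, OF Z] w(2)[OF uv(2)] by simp
      show "(?Z (\<eta> ` \<mu> u) ^^ m) (\<eta> q) (h u)"
        using relpowp_map[OF m, of "?Z (\<eta> ` \<mu> u)" \<eta>, OF Z] w(2)[OF uv(1)] by simp
      show "\<eta> p = \<eta> q \<or> R (\<eta> p) (\<eta> q) \<or> R (\<eta> q) (\<eta> p)" using \<eta>_adj[OF pq(3)] by metis
    qed (use h_le uv pq that in blast)+
    then show ?thesis using descents_mono[of "Suc n" "2 * r + 1"] n(1) by auto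
  qed
  have J_adj: "h u = h v \<or> adj J (h u) (h v)" if "adj G u v" for u v
  proof -
    note uv = graph_adjD[OF assms(4) that]
    have "h v \<in> descents R (2 * r + 1) (h u) \<or> h u \<in> descents R (2 * r + 1) (h v)"
      using descend[OF that] descend[OF uv(4)] by linarith
    then show ?thesis using hJ[OF uv(1)] hJ[OF uv(2)] unfolding J by blast
  qed

  \<comment> \<open>A step in \<open>W\<close> may leave the \<open>L\<close>-coordinate
    unchanged.\<close>
  let ?Y = "\<lambda>a b. a = b \<or> adj L a b"
  have Y: "?Y (\<beta> p) (\<beta> q)" if "adj_in W S p q" for S p q
    using that W_adj(2) by (auto simp: adj_in_def)
  have to_centre: "\<exists>n\<le>r. (?Y ^^ n) (b v) (\<beta> p)" if "v \<in> verts G" "p \<in> \<mu> v" for v p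
  proof -
    from c(2)[OF that] obtain n where n: "n \<le> r" "(adj_in W (\<mu> v) ^^ n) (c v) p" by blast
    have "(?Y ^^ n) (\<beta> (c v)) (\<beta> p)" using n(2) by (rule relpowp_map) (rule Y)
    then show ?thesis using n(1) unfolding b_def by blast
  qed
  have Y_sym: "?Y y x" if "?Y x y" for x y using that graph_adjD(4)[OF assms(3)] by blast
  \<comment> \<open>At most \<open>r\<close> steps from one centre to the joining edge, one across
    it, and \<open>r\<close> to the other centre.\<close>
  have L_adj: "b u = b v \<or> adj (graph_power L (2 * r + 1)) (b u) (b v)" if "adj G u v" for u v
  proof -
    note uv = graph_adjD[OF assms(4) that]
    from edge[OF that] obtain p q where pq: "p \<in> \<mu> u" "q \<in> \<mu> v" "adj W p q" by blast
    obtain m n where mn: "m \<le> r" "(?Y ^^ m) (b u) (\<beta> p)" "n \<le> r" "(?Y ^^ n) (b v) (\<beta> q)"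
      using to_centre[OF uv(1) pq(1)] to_centre[OF uv(2) pq(2)] by blast
    have "(?Y ^^ Suc m) (b u) (\<beta> q)" using relpowp_Suc_I[OF mn(2)] W_adj(2)[OF pq(3)] by blast
    from relpowp_trans[OF this relpowp_sym[OF mn(4) Y_sym]]
    have "(?Y ^^ (Suc m + n)) (b u) (b v)" .
    from relpowp_reflclp[OF this] obtain i where "i \<le> Suc m + n" "(adj L ^^ i) (b u) (b v)" by blast
    moreover from this have "i \<le> 2 * r + 1" using mn(1,3) by simp
    ultimately show ?thesis using bL uv by (auto simp: adj_graph_power)
  qed

  have fibre: "card {v \<in> verts G. (h v, b v) = (x, y)} \<le> l * (k + 1)" for x y
  \<comment> \<open>Nonemptiness of the fibre makes \<open>y\<close> a vertex of \<open>L\<close>,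
    as the degree bound requires.\<close>
  proof (cases "{v \<in> verts G. (h v, b v) = (x, y)} = {}")
    case False
    let ?F = "{v \<in> verts G. (h v, b v) = (x, y)}"
    let ?N = "insert y {u. adj (graph_power L r) y u}"
    have y: "y \<in> verts L" using False bL by auto
    note N = card_graph_power_neighbourhood[OF assms(3) y assms(6)]
    let ?\<phi> = "\<lambda>v. (\<beta> (w v), snd (w v))"
    \<comment> \<open>In a fibre the \<open>H\<close>-coordinate of \<open>w v\<close> is fixed,
      since \<open>\<rho>\<close> is injective. The other two coordinates then determine
      \<open>w v\<close>, and disjointness of the branch sets determines \<open>v\<close>.\<close>
    have "inj_on ?\<phi> ?F"
    proof (rule inj_onI)
      fix u v assume uv: "u \<in> ?F" "v \<in> ?F" "?\<phi> u = ?\<phi> v"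
      then have V: "u \<in> verts G" "v \<in> verts G" "h u = h v" by auto
      have "\<rho> (fst (fst (w u))) = \<rho> (fst (fst (w v)))" using w(2) V by (simp add: \<eta>_def)
      then have "fst (fst (w u)) = fst (fst (w v))" using inj wH V by (meson inj_onD)
      then have "w u = w v" using uv(3) by (simp add: \<beta>_def prod_eq_iff)
      then show "u = v" using disj[OF V(1,2)] w(1) V by (metis IntI emptyE)
    qed
    moreover have "?\<phi> ` ?F \<subseteq> ?N \<times> {0..<l}"
    proof
      fix z assume "z \<in> ?\<phi> ` ?F"
      then obtain v where v: "v \<in> verts G" "b v = y" "z = ?\<phi> v" by auto
      obtain n where n: "n \<le> r" "(?Y ^^ n) (b v) (\<beta> (w v))"
        using to_centre[OF v(1) w(1)[OF v(1)]] by blast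
      obtain i where i: "i \<le> n" "(adj L ^^ i) y (\<beta> (w v))"
        using relpowp_reflclp[OF n(2)] v(2) by blast
      then have "\<beta> (w v) \<in> ?N"
        using y wH(2)[OF v(1)] n(1) order_trans by (auto simp: adj_graph_power)
      then show "z \<in> ?N \<times> {0..<l}" using v wH(3) by simp
    qed
    ultimately have "card ?F \<le> card (?N \<times> {0..<l})"
      using N(1) by (intro card_inj_on_le) auto
    also have "\<dots> \<le> (k + 1) * l"
      using mult_le_mono1[OF N(2), of l] by (simp add: card_cartesian_product)
    finally show ?thesis by (simp only: mult.commute)
  next
    case True
    then show ?thesis by (simp only: card.empty)
  qed
  have finG: "finite (verts G)" using assms(4) by (simp add: graph_def)
  obtain g :: "'c \<Rightarrow> nat" where g: "\<And>v. v \<in> verts G \<Longrightarrow> g v < l * (k + 1)"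
    "inj_on (\<lambda>v. ((h v, b v), g v)) (verts G)"
    using fibre_indexing[OF finG, of "\<lambda>v. (h v, b v)" "l * (k + 1)"] fibre by fast
  have "contained_in G (strong_prod (strong_prod J (graph_power L (2 * r + 1)))
      (complete_graph (l * (k + 1))))"
    unfolding contained_in_def
  proof (intro exI conjI allI impI)
    let ?f = "\<lambda>v. ((h v, b v), g v)"
    show "inj_on ?f (verts G)" by (rule g(2))
    show sub: "?f ` verts G \<subseteq> verts (strong_prod (strong_prod J (graph_power L (2 * r + 1)))
      (complete_graph (l * (k + 1))))"
      using hJ bL g(1) by auto
    show "adj (strong_prod (strong_prod J (graph_power L (2 * r + 1)))
      (complete_graph (l * (k + 1)))) (?f u) (?f v)" if "adj G u v" for u v
    proof -
      note uv = graph_adjD[OF assms(4) that]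
      \<comment> \<open>Third coordinates are always equal or adjacent in a complete graph, so
        besides the first two coordinates only distinctness of the images matters.\<close>
      have "?f u \<noteq> ?f v" using g(2) uv by (meson inj_onD)
      then show ?thesis
        unfolding adj_strong_prod[OF graph_complete_graph]
          adj_strong_prod[OF graph_graph_power[OF assms(3)]]
        using J_adj[OF that] L_adj[OF that] hJ bL g(1) uv
        by (auto simp del: mult_Suc_right)
    qed
  qed
  then show ?thesis using gJ tJ by blast
qed

end
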